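(* Let $m$ be a nonnegative integer. For every $t\in\mathbb R$ and $q\in\mathbb H$, $$A_m(t;q)=\frac{\exp\left(-\frac{t^2}{2}-\frac{\overline q^{\,2}}{2}+\sqrt2\,\overline q\,t\right)}{\pi^{3/4}(\sqrt2)^m\sqrt{m!}}\,H_m\!\left(\frac{q+\overline q}{\sqrt2}-t\right).$$
   Context: $\mathbb H$ is the division algebra of real quaternions. The real Hermite functions are $h_n(t)=(-1)^ne^{t^2/2}\frac{d^n}{dt^n}(e^{-t^2})=e^{-t^2/2}H_n(t)$, where $H_n(t)=(-1)^ne^{t^2}\frac{d^n}{dt^n}e^{-t^2}$ are the real Hermite polynomials. The quaternionic Hermite polynomials are $$H_{m,n}(q,\overline q)=m!\,n!\sum_{j=0}^{\min(m,n)}\frac{(-1)^j}{j!}\frac{q^{m-j}\overline q^{\,n-j}}{(m-j)!(n-j)!}.$$ The kernel function is $$A_m(t;q)=\sum_{n=0}^{+\infty}\frac{h_n(t)H_{m,n}(q,\overline q)}{\|h_n\|\,\|H_{m,n}\|},$$ where $\|h_n\|=(2^nn!\sqrt\pi)^{1/2}$ and $\|H_{m,n}\|=(\pi\,m!\,n!)^{1/2}$. *)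

theory Defs
  imports "HOL-Analysis.Analysis"
begin

section \<open>The division algebra of real quaternions\<close>

codatatype quat = Quat (qRe: real) (qIm1: real) (qIm2: real) (qIm3: real)

lemma quat_eq_iff:
  "x = y \<longleftrightarrow> qRe x = qRe y \<and> qIm1 x = qIm1 y \<and> qIm2 x = qIm2 y \<and> qIm3 x = qIm3 y"
  by (cases x; cases y) auto

lemma quat_eqI:
  "\<lbrakk>qRe x = qRe y; qIm1 x = qIm1 y; qIm2 x = qIm2 y; qIm3 x = qIm3 y\<rbrakk> \<Longrightarrow> x = y"
  by (simp add: quat_eq_iff)

instantiation quat :: ab_group_add
begin

primcorec zero_quat where
  "qRe 0 = 0" | "qIm1 0 = 0" | "qIm2 0 = 0" | "qIm3 0 = 0"

primcorec plus_quat where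
  "qRe (x + y) = qRe x + qRe y"
| "qIm1 (x + y) = qIm1 x + qIm1 y"
| "qIm2 (x + y) = qIm2 x + qIm2 y"
| "qIm3 (x + y) = qIm3 x + qIm3 y"

primcorec uminus_quat where
  "qRe (- x) = - qRe x"
| "qIm1 (- x) = - qIm1 x"
| "qIm2 (- x) = - qIm2 x"
| "qIm3 (- x) = - qIm3 x"

primcorec minus_quat where
  "qRe (x - y) = qRe x - qRe y"
| "qIm1 (x - y) = qIm1 x - qIm1 y"
| "qIm2 (x - y) = qIm2 x - qIm2 y"
| "qIm3 (x - y) = qIm3 x - qIm3 y"

instance
  by standard (simp_all add: quat_eq_iff)

end

instantiation quat :: ring_1
begin

primcorec one_quat where
  "qRe 1 = 1" | "qIm1 1 = 0" | "qIm2 1 = 0" | "qIm3 1 = 0"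

primcorec times_quat where
  "qRe (x * y) = qRe x * qRe y - qIm1 x * qIm1 y - qIm2 x * qIm2 y - qIm3 x * qIm3 y"
| "qIm1 (x * y) = qRe x * qIm1 y + qIm1 x * qRe y + qIm2 x * qIm3 y - qIm3 x * qIm2 y"
| "qIm2 (x * y) = qRe x * qIm2 y - qIm1 x * qIm3 y + qIm2 x * qRe y + qIm3 x * qIm1 y"
| "qIm3 (x * y) = qRe x * qIm3 y + qIm1 x * qIm2 y - qIm2 x * qIm1 y + qIm3 x * qRe y"

instance
  by standard (simp_all add: quat_eq_iff algebra_simps)

end

instantiation quat :: real_algebra_1
begin

primcorec scaleR_quat where
  "qRe (scaleR r x) = r * qRe x"
| "qIm1 (scaleR r x) = r * qIm1 x"
| "qIm2 (scaleR r x) = r * qIm2 x"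
| "qIm3 (scaleR r x) = r * qIm3 x"

instance
  by standard (simp_all add: quat_eq_iff algebra_simps)

end

primcorec qcnj :: "quat \<Rightarrow> quat" where
  "qRe (qcnj x) = qRe x"
| "qIm1 (qcnj x) = - qIm1 x"
| "qIm2 (qcnj x) = - qIm2 x"
| "qIm3 (qcnj x) = - qIm3 x"

lemma qcnj_mult: "qcnj (x * y) = qcnj y * qcnj x"
  by (simp add: quat_eq_iff algebra_simps)

instantiation quat :: real_inner
begin

definition inner_quat :: "quat \<Rightarrow> quat \<Rightarrow> real" where
  "inner_quat x y = qRe x * qRe y + qIm1 x * qIm1 y + qIm2 x * qIm2 y + qIm3 x * qIm3 y"

definition norm_quat :: "quat \<Rightarrow> real" where
  "norm_quat x = sqrt (inner x x)"

definition sgn_quat :: "quat \<Rightarrow> quat" where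
  "sgn_quat x = x /\<^sub>R norm x"

definition dist_quat :: "quat \<Rightarrow> quat \<Rightarrow> real" where
  "dist_quat x y = norm (x - y)"

definition uniformity_quat :: "(quat \<times> quat) filter" where
  "uniformity_quat = (INF e\<in>{0 <..}. principal {(x, y). dist x y < e})"

definition open_quat :: "quat set \<Rightarrow> bool" where
  "open_quat U \<longleftrightarrow> (\<forall>x\<in>U. eventually (\<lambda>(x', y). x' = x \<longrightarrow> y \<in> U) uniformity)"

instance
proof
  fix x y z :: quat and r :: real
  show "inner x y = inner y x"
    by (simp add: inner_quat_def algebra_simps)
  show "inner (x + y) z = inner x z + inner y z"
    by (simp add: inner_quat_def algebra_simps)
  show "inner (r *\<^sub>R x) y = r * inner x y"
    by (simp add: inner_quat_def algebra_simps)
  show "0 \<le> inner x x"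
    by (simp add: inner_quat_def)
  show "inner x x = 0 \<longleftrightarrow> x = 0"
    by (simp add: inner_quat_def quat_eq_iff add_nonneg_eq_0_iff)
qed (simp_all add: norm_quat_def sgn_quat_def dist_quat_def uniformity_quat_def open_quat_def)

end

instantiation quat :: real_normed_div_algebra
begin

definition inverse_quat :: "quat \<Rightarrow> quat" where
  "inverse_quat x = qcnj x /\<^sub>R (norm x)\<^sup>2"

definition divide_quat :: "quat \<Rightarrow> quat \<Rightarrow> quat" where
  "divide_quat x y = x * inverse y"

instance
proof
  fix x y :: quat
  have norm2: "(norm x)\<^sup>2 = (qRe x)\<^sup>2 + (qIm1 x)\<^sup>2 + (qIm2 x)\<^sup>2 + (qIm3 x)\<^sup>2" for x :: quat
    by (simp add: norm_quat_def inner_quat_def power2_eq_square)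
  have conj: "qcnj x * x = (norm x)\<^sup>2 *\<^sub>R 1" "x * qcnj x = (norm x)\<^sup>2 *\<^sub>R 1" for x :: quat
    unfolding norm2 by (simp_all add: quat_eq_iff power2_eq_square)
  show "inverse x * x = 1" "x * inverse x = 1" if "x \<noteq> 0"
    using that by (simp_all add: inverse_quat_def conj)
  show "inverse (0::quat) = 0"
    by (simp add: inverse_quat_def quat_eq_iff)
  show "x div y = x * inverse y"
    by (simp add: divide_quat_def)
  have "(norm (x * y))\<^sup>2 *\<^sub>R (1::quat) = x * (y * qcnj y) * qcnj x"
    by (simp add: conj(2)[symmetric] qcnj_mult mult.assoc)
  also have "\<dots> = (norm x * norm y)\<^sup>2 *\<^sub>R (1::quat)"
    by (simp add: conj(2) power_mult_distrib mult.commute)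
  finally have "(norm (x * y))\<^sup>2 = (norm x * norm y)\<^sup>2"
    by (simp only: scaleR_cancel_right one_neq_zero simp_thms)
  then show "norm (x * y) = norm x * norm y"
    by simp
qed

end

instantiation quat :: euclidean_space
begin

definition Basis_quat :: "quat set" where
  "Basis_quat = {Quat 1 0 0 0, Quat 0 1 0 0, Quat 0 0 1 0, Quat 0 0 0 1}"

instance
proof
  fix u v x :: quat
  show "(Basis :: quat set) \<noteq> {}" "finite (Basis :: quat set)"
    by (simp_all add: Basis_quat_def)
  show "inner u v = (if u = v then 1 else 0)" if "u \<in> Basis" "v \<in> Basis"
    using that unfolding Basis_quat_def
    by (elim insertE emptyE; hypsubst) (simp_all add: inner_quat_def)
  show "(\<forall>u\<in>Basis. inner x u = 0) \<longleftrightarrow> x = 0"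
    by (simp add: Basis_quat_def inner_quat_def quat_eq_iff[of x 0])
qed

end

text \<open>In particular quaternions form a Banach algebra, so that the library's power series
  \<^const>\<open>exp\<close> and convergence of series apply to them.\<close>

instance quat :: banach ..

lemma quat_of_real_sel [simp]:
  "qRe (of_real r) = r" "qIm1 (of_real r) = 0" "qIm2 (of_real r) = 0" "qIm3 (of_real r) = 0"
  by (simp_all add: of_real_def)

lemma quat_numeral_sel [simp]:
  "qRe (numeral k) = numeral k" "qIm1 (numeral k) = 0"
  "qIm2 (numeral k) = 0" "qIm3 (numeral k) = 0"
  using quat_of_real_sel[of "numeral k"] by simp_all


section \<open>Real Hermite polynomials and Hermite functions\<close>

definition hermite_H :: "nat \<Rightarrow> real \<Rightarrow> real" where
  "hermite_H n t = (-1) ^ n * exp (t\<^sup>2) * (deriv ^^ n) (\<lambda>s. exp (- s\<^sup>2)) t"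

definition hermite_h :: "nat \<Rightarrow> real \<Rightarrow> real" where
  "hermite_h n t = (-1) ^ n * exp (t\<^sup>2 / 2) * (deriv ^^ n) (\<lambda>s. exp (- s\<^sup>2)) t"

lemma hermite_h_eq: "hermite_h n t = exp (- t\<^sup>2 / 2) * hermite_H n t"
proof -
  have "exp (t\<^sup>2 / 2) = exp (- t\<^sup>2 / 2) * exp (t\<^sup>2)"
    by (simp flip: exp_add)
  then show ?thesis
    by (simp add: hermite_h_def hermite_H_def)
qed

definition norm_h :: "nat \<Rightarrow> real" where
  "norm_h n = sqrt (2 ^ n * fact n * sqrt pi)"


section \<open>Quaternionic Hermite polynomials and the kernel\<close>

definition quat_hermite :: "nat \<Rightarrow> nat \<Rightarrow> quat \<Rightarrow> quat" where
  "quat_hermite m n q =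
     (fact m * fact n) *\<^sub>R
       (\<Sum>j = 0..min m n.
          ((-1) ^ j / fact j) *\<^sub>R
            ((q ^ (m - j) * qcnj q ^ (n - j)) /\<^sub>R (fact (m - j) * fact (n - j))))"

definition norm_quat_hermite :: "nat \<Rightarrow> nat \<Rightarrow> real" where
  "norm_quat_hermite m n = sqrt (pi * fact m * fact n)"

definition kernel_term :: "nat \<Rightarrow> real \<Rightarrow> quat \<Rightarrow> nat \<Rightarrow> quat" where
  "kernel_term m t q n =
     (hermite_h n t *\<^sub>R quat_hermite m n q) /\<^sub>R (norm_h n * norm_quat_hermite m n)"

definition kernel_A :: "nat \<Rightarrow> real \<Rightarrow> quat \<Rightarrow> quat" where
  "kernel_A m t q = (\<Sum>n. kernel_term m t q n)"

text \<open>The quaternion $(q + \overline q)/\sqrt2 - t$ is real, so the real Hermite polynomial can be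
  evaluated at it; \<^term>\<open>qRe\<close> is the coercion back to the reals and loses nothing.\<close>

lemma of_real_hermite_arg:
  "of_real (qRe ((q + qcnj q) / of_real (sqrt 2) - of_real t)) =
     (q + qcnj q) / of_real (sqrt 2) - of_real t"
  by (simp add: quat_eq_iff divide_inverse flip: of_real_inverse)

end

theory Submission
  imports Defs "HOL-Complex_Analysis.Cauchy_Integral_Formula"
begin

text \<open>
  The coefficients of \<open>H\<^bsub>m,n\<^esub>(q, q\<^sup>*)\<close>, where \<open>q\<^sup>*\<close> denotes the conjugate, are real, and \<open>q\<close>
  and \<open>q\<^sup>*\<close> lie in a common commutative subalgebra \<open>\<real> + \<real>I\<close> with \<open>I\<^sup>2 = -1\<close>. That subalgebra is a
  copy of the complex numbers, so everything reduces to the case of a complex number \<open>z\<close>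
  (\<open>quat_in_slice\<close>, \<open>kernel_term_slice\<close>).

  After the normalising constants are cleared, the \<open>n\<close>-th term is a finite sum over \<open>j \<le> m\<close> of
  multiples of \<open>H\<^sub>n(t) u\<^bsup>n-j\<^esup> / (n-j)!\<close> with \<open>u = z\<^sup>*/\<surd>2\<close>. For fixed \<open>j\<close>, the series over \<open>n\<close> is the
  Taylor series, taken at \<open>t\<close> and evaluated at \<open>t - u\<close>, of the \<open>j\<close>-th derivative of the entire
  function \<open>exp(-x\<^sup>2)\<close>. Its sum is \<open>exp(2tu - u\<^sup>2) H\<^sub>j(t - u)\<close>
  (\<open>hermite_C_shifted_generating_function\<close>). Up to a constant factor, what remains is the
  finite sum
  \<open>\<Sum>\<^sub>j (m choose j) (\<surd>2 z)\<^bsup>m-j\<^esup> (-1)\<^sup>j H\<^sub>j(t - u)\<close>. By parity the sign turns \<open>H\<^sub>j(t - u)\<close> into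
  \<open>H\<^sub>j(u - t)\<close>, and the addition formula (\<open>hermite_C_add\<close>), which is the Leibniz rule applied to
  \<open>exp(-(x+w)\<^sup>2) = exp(-w\<^sup>2) exp(-2wx) exp(-x\<^sup>2)\<close>, collapses it to \<open>H\<^sub>m(u - t + z/\<surd>2)\<close>. Because
  \<open>z + z\<^sup>*\<close> is real, this is a value of the real Hermite polynomial.
\<close>

section \<open>Derivatives of the complex Gaussian\<close>

definition gauss :: "complex \<Rightarrow> complex" where
  "gauss z = exp (- z\<^sup>2)"

lemma gauss_nonzero [simp]: "gauss z \<noteq> 0"
  by (simp add: gauss_def)

lemma holomorphic_gauss: "gauss holomorphic_on S"
  unfolding gauss_def by (intro holomorphic_intros)

lemma holomorphic_gauss_deriv: "(deriv ^^ n) gauss holomorphic_on S"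
  using holomorphic_higher_deriv[OF holomorphic_gauss open_UNIV] holomorphic_on_subset by blast

lemma gauss_add: "gauss (z + w) = gauss z * exp (- 2 * w * z) * gauss w"
  by (simp add: gauss_def power2_eq_square algebra_simps flip: exp_add)

text \<open>The real Hermite polynomials are defined by iterated real derivatives, whereas Taylor
  expansion and the Leibniz rule are used for complex ones. In the induction step the complex
  derivative is computed along the real axis, where the function to be differentiated is
  real-valued.\<close>

lemma gauss_deriv_of_real:
  "(deriv ^^ n) gauss (of_real t) = of_real ((deriv ^^ n) (\<lambda>s. exp (- s\<^sup>2)) t)"
proof (induction n arbitrary: t)
  case 0
  show ?case
    by (simp add: gauss_def flip: exp_of_real)
next
  case (Suc n)
  define F where "F = (deriv ^^ n) gauss"
  define G where "G = (deriv ^^ n) (\<lambda>s::real. exp (- s\<^sup>2))"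
  have FG: "F (of_real s) = of_real (G s)" for s
    unfolding F_def G_def by (rule Suc.IH)
  have "(F has_field_derivative deriv F (of_real t)) (at (of_real t))"
    unfolding F_def
    using holomorphic_gauss_deriv[of n UNIV] by (intro holomorphic_derivI) auto
  then have "((\<lambda>s. F (of_real s)) has_vector_derivative deriv F (of_real t)) (at t)"
    by (rule has_vector_derivative_real_field)
  then have D: "((\<lambda>s. complex_of_real (G s)) has_vector_derivative deriv F (of_real t)) (at t)"
    by (simp add: FG)
  have "(G has_vector_derivative Re (deriv F (of_real t))) (at t)"
    using bounded_linear.has_vector_derivative[OF bounded_linear_Re D] by simp
  then have "(G has_real_derivative Re (deriv F (of_real t))) (at t)"
    by (simp add: has_real_derivative_iff_has_vector_derivative)
  then have 1: "deriv G t = Re (deriv F (of_real t))"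
    by (rule DERIV_imp_deriv)
  have "((\<lambda>s. 0::real) has_vector_derivative Im (deriv F (of_real t))) (at t)"
    using bounded_linear.has_vector_derivative[OF bounded_linear_Im D] by simp
  then have 2: "Im (deriv F (of_real t)) = 0"
    using vector_derivative_unique_at has_vector_derivative_const by blast
  show ?case
    using 1 2 by (simp add: F_def G_def complex_eq_iff)
qed

section \<open>Hermite polynomials of a complex variable\<close>

text \<open>Dividing by the Gaussian, instead of multiplying by \<open>exp(z\<^sup>2)\<close>, lets the exponential factors
  below cancel by simplification.\<close>

definition hermite_C :: "nat \<Rightarrow> complex \<Rightarrow> complex" where
  "hermite_C n z = (-1) ^ n * (deriv ^^ n) gauss z / gauss z"

lemma hermite_C_of_real: "hermite_C n (of_real t) = of_real (hermite_H n t)"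
  unfolding hermite_C_def hermite_H_def gauss_deriv_of_real
  by (simp add: gauss_def exp_minus field_simps flip: exp_of_real)

lemma hermite_C_minus: "hermite_C n (- z) = (-1) ^ n * hermite_C n z"
proof -
  have "(\<lambda>w. gauss (-1 * w)) = gauss"
    by (simp add: gauss_def fun_eq_iff)
  then have "(deriv ^^ n) gauss z = (-1) ^ n * (deriv ^^ n) gauss (- z)"
    using higher_deriv_compose_linear[OF holomorphic_gauss[of UNIV] open_UNIV open_UNIV, of z "-1" n]
    by simp
  moreover have "gauss (- z) = gauss z"
    by (simp add: gauss_def)
  ultimately show ?thesis
    by (simp add: hermite_C_def)
qed

text \<open>Up to the factor \<open>(-1)\<^sup>j / exp(-z\<^sup>2)\<close> this is the Taylor expansion at \<open>z\<close> of the \<open>j\<close>-th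
  derivative of the Gaussian, evaluated at \<open>z - w\<close>; the sign of the increment \<open>-w\<close> is absorbed by
  the factor \<open>(-1)\<^sup>k\<close> in the Hermite polynomials.\<close>

lemma hermite_C_shifted_generating_function:
  "(\<lambda>k. hermite_C (k + j) z * w ^ k / fact k) sums
     (exp (2 * z * w - w\<^sup>2) * hermite_C j (z - w))"
proof -
  have iter: "(deriv ^^ k) ((deriv ^^ j) gauss) = (deriv ^^ (k + j)) gauss" for k
    by (simp add: funpow_add)
  have "(\<lambda>k. (deriv ^^ k) ((deriv ^^ j) gauss) z / fact k * ((z - w) - z) ^ k) sums
          (deriv ^^ j) gauss (z - w)"
    by (rule holomorphic_power_series[where r = "norm w + 1"])
       (auto simp: holomorphic_gauss_deriv dist_norm)
  then have "(\<lambda>k. (deriv ^^ (k + j)) gauss z / fact k * (- w) ^ k) sums (deriv ^^ j) gauss (z - w)"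
    by (simp add: iter)
  then have "(\<lambda>k. (-1) ^ j / gauss z * ((deriv ^^ (k + j)) gauss z / fact k * (- w) ^ k)) sums
               ((-1) ^ j / gauss z * (deriv ^^ j) gauss (z - w))"
    by (rule sums_mult)
  moreover have "(-1) ^ j / gauss z * ((deriv ^^ (k + j)) gauss z / fact k * (- w) ^ k)
                   = hermite_C (k + j) z * w ^ k / fact k" for k
    by (simp add: hermite_C_def power_add power_minus[of w])
  moreover have "(-1) ^ j / gauss z * (deriv ^^ j) gauss (z - w)
                   = exp (2 * z * w - w\<^sup>2) * hermite_C j (z - w)"
  proof -
    have "gauss (z - w) = gauss z * exp (2 * z * w - w\<^sup>2)"
      by (simp add: gauss_def power2_eq_square algebra_simps flip: exp_add)
    then show ?thesis
      by (simp add: hermite_C_def)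
  qed
  ultimately show ?thesis
    by simp
qed

text \<open>The Leibniz rule, applied to the factorisation of \<open>gauss (x + w)\<close> as \<open>gauss x\<close> times an
  exponential of a linear function of \<open>x\<close>, whose derivatives are powers of \<open>-2w\<close> times itself.\<close>

lemma hermite_C_add:
  "hermite_C m (z + w) = (\<Sum>j\<le>m. of_nat (m choose j) * (2 * w) ^ (m - j) * hermite_C j z)"
proof -
  define e where "e = (\<lambda>z. exp (- 2 * w * z) * gauss w)"
  have e_deriv: "(deriv ^^ k) e x = (- 2 * w) ^ k * e x" for k x
  proof (induction k arbitrary: x)
    case (Suc k)
    then have "(deriv ^^ k) e = (\<lambda>x. (- 2 * w) ^ k * e x)"
      by blast
    moreover have "((\<lambda>x. (- 2 * w) ^ k * e x) has_field_derivative (- 2 * w) ^ Suc k * e x) (at x)"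
      unfolding e_def by (auto intro!: derivative_eq_intros)
    ultimately show ?case
      by (simp add: DERIV_imp_deriv)
  qed simp
  have e_holo: "e holomorphic_on UNIV"
    unfolding e_def by (intro holomorphic_intros)
  have shift: "(\<lambda>x. gauss (1 * x + w)) = (\<lambda>x. gauss x * e x)"
    by (simp add: gauss_add e_def fun_eq_iff)
  have "(deriv ^^ m) gauss (z + w) = (deriv ^^ m) (\<lambda>x. gauss (1 * x + w)) z"
    by (subst higher_deriv_compose_linear'[OF holomorphic_gauss[of UNIV] open_UNIV open_UNIV]) auto
  also have "\<dots> = (\<Sum>j=0..m. of_nat (m choose j) * (deriv ^^ j) gauss z * (deriv ^^ (m - j)) e z)"
    unfolding shift
    by (rule higher_deriv_mult[OF holomorphic_gauss e_holo open_UNIV]) simp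
  finally have deriv_sum: "(deriv ^^ m) gauss (z + w) =
      (\<Sum>j=0..m. of_nat (m choose j) * (deriv ^^ j) gauss z * ((- 2 * w) ^ (m - j) * e z))"
    by (simp only: e_deriv)
  have "gauss (z + w) = gauss z * e z"
    by (simp add: gauss_add e_def)
  then have "hermite_C m (z + w) =
      (\<Sum>j=0..m. (-1) ^ m * (of_nat (m choose j) * (deriv ^^ j) gauss z * ((- 2 * w) ^ (m - j) * e z))
                   / (gauss z * e z))"
    by (simp only: hermite_C_def deriv_sum sum_distrib_left sum_divide_distrib)
  also have "\<dots> = (\<Sum>j\<le>m. of_nat (m choose j) * (2 * w) ^ (m - j) * hermite_C j z)"
    unfolding atMost_atLeast0
  proof (rule sum.cong)
    fix j assume "j \<in> {0..m}"
    then have "(-1::complex) ^ m = (-1) ^ (m - j) * (-1) ^ j"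
      by (simp flip: power_add)
    moreover have "(- 2 * w) ^ (m - j) = (-1) ^ (m - j) * (2 * w) ^ (m - j)"
      using power_minus[of "2 * w" "m - j"] by simp
    moreover have "e z \<noteq> 0"
      by (simp add: e_def)
    ultimately show "(-1) ^ m * (of_nat (m choose j) * (deriv ^^ j) gauss z * ((- 2 * w) ^ (m - j) * e z))
                   / (gauss z * e z) = of_nat (m choose j) * (2 * w) ^ (m - j) * hermite_C j z"
      by (simp add: hermite_C_def)
  qed simp
  finally show ?thesis .
qed

section \<open>The kernel on a complex slice\<close>

text \<open>The next two definitions copy those over the quaternions literally, so that a real-linear
  ring homomorphism from the complex numbers that respects conjugation carries one to the
  other.\<close>

definition complex_hermite :: "nat \<Rightarrow> nat \<Rightarrow> complex \<Rightarrow> complex" where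
  "complex_hermite m n z =
     (fact m * fact n) *\<^sub>R
       (\<Sum>j = 0..min m n.
          ((-1) ^ j / fact j) *\<^sub>R
            ((z ^ (m - j) * cnj z ^ (n - j)) /\<^sub>R (fact (m - j) * fact (n - j))))"

definition complex_kernel_term :: "nat \<Rightarrow> real \<Rightarrow> complex \<Rightarrow> nat \<Rightarrow> complex" where
  "complex_kernel_term m t z n =
     (hermite_h n t *\<^sub>R complex_hermite m n z) /\<^sub>R (norm_h n * norm_quat_hermite m n)"

lemma normalisation_factor:
  "norm_h n * norm_quat_hermite m n = pi powr (3 / 4) * sqrt (fact m) * sqrt 2 ^ n * fact n"
proof -
  have "sqrt (sqrt pi) * sqrt pi = pi powr (3 / 4)"
    by (simp add: powr_half_sqrt[symmetric] powr_powr flip: powr_add)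
  then have "sqrt (sqrt pi) * sqrt pi * sqrt (fact m) * sqrt 2 ^ n * (sqrt (fact n) * sqrt (fact n)) =
      pi powr (3 / 4) * sqrt (fact m) * sqrt 2 ^ n * fact n"
    by simp
  then show ?thesis
    by (simp only: norm_h_def norm_quat_hermite_def real_sqrt_mult real_sqrt_power mult_ac)
qed

text \<open>Extending the sum by zeros to a range independent of \<open>n\<close> allows summation over \<open>n\<close> for each
  fixed \<open>j\<close>.\<close>

lemma complex_hermite_altdef:
  "complex_hermite m n z / fact n =
     (\<Sum>j\<le>m. if j \<le> n then of_nat (m choose j) * (-1) ^ j * z ^ (m - j) * (cnj z ^ (n - j) / fact (n - j)) else 0)"
proof -
  have "complex_hermite m n z / fact n =
     (\<Sum>j\<in>{0..min m n}. of_nat (m choose j) * (-1) ^ j * z ^ (m - j) * (cnj z ^ (n - j) / fact (n - j)))"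
    unfolding complex_hermite_def scaleR_sum_right sum_divide_distrib
    by (intro sum.cong refl)
       (auto simp: scaleR_conv_of_real binomial_fact field_simps)
  also have "\<dots> = (\<Sum>j\<in>{j\<in>{..m}. j \<le> n}. of_nat (m choose j) * (-1) ^ j * z ^ (m - j) * (cnj z ^ (n - j) / fact (n - j)))"
    by (intro sum.cong refl) auto
  finally show ?thesis
    by (simp only: sum.inter_filter finite_atMost)
qed

text \<open>Summation over \<open>n\<close> uses the shifted generating function for each \<open>j\<close>, and summation over \<open>j\<close>
  the addition formula with increment \<open>z/\<surd>2\<close>, for which \<open>(2z/\<surd>2)\<^bsup>m-j\<^esup>\<close> accounts exactly for the
  discrepancy between \<open>(\<surd>2)\<^sup>-\<^sup>j\<close> and \<open>(\<surd>2)\<^sup>-\<^sup>m\<close>.\<close>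

lemma complex_kernel_sums:
  "complex_kernel_term m t z sums
     (exp (- of_real (t\<^sup>2) / 2 - (cnj z)\<^sup>2 / 2 + of_real (sqrt 2) * cnj z * of_real t)
        / of_real (pi powr (3 / 4) * sqrt 2 ^ m * sqrt (fact m))
        * hermite_C m ((z + cnj z) / of_real (sqrt 2) - of_real t))"
proof -
  define r :: complex where "r = of_real (sqrt 2)"
  define T :: complex where "T = of_real t"
  define u where "u = cnj z / r"
  define c :: complex where "c = of_real (exp (- t\<^sup>2 / 2) / (pi powr (3 / 4) * sqrt (fact m)))"
  define b where "b = (\<lambda>j. c * of_nat (m choose j) * (-1) ^ j * z ^ (m - j) / r ^ j)"
  have r: "r \<noteq> 0" "r * r = 2" "r\<^sup>2 = 2"
    by (simp_all add: r_def power2_eq_square flip: of_real_mult)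
  have term_eq: "complex_kernel_term m t z n =
      (\<Sum>j\<le>m. if j \<le> n then b j * (hermite_C n T * u ^ (n - j) / fact (n - j)) else 0)" for n
  proof -
    have "complex_of_real (hermite_h n t / (norm_h n * norm_quat_hermite m n)) =
        c / r ^ n * hermite_C n T / fact n"
      unfolding normalisation_factor T_def hermite_C_of_real hermite_h_eq c_def r_def
      by (simp add: mult.assoc)
    moreover have "complex_kernel_term m t z n =
        of_real (hermite_h n t / (norm_h n * norm_quat_hermite m n)) * complex_hermite m n z"
      unfolding complex_kernel_term_def
      by (simp only: scaleR_conv_of_real divide_inverse of_real_mult mult_ac)
    ultimately have "complex_kernel_term m t z n =
        c / r ^ n * hermite_C n T * (complex_hermite m n z / fact n)"
      by simp
    also have "\<dots> = (\<Sum>j\<le>m. if j \<le> n then b j * (hermite_C n T * u ^ (n - j) / fact (n - j)) else 0)"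
      unfolding complex_hermite_altdef sum_distrib_left
    proof (intro sum.cong refl)
      fix j
      have "r ^ n = r ^ j * r ^ (n - j)" if "j \<le> n"
        using that by (simp flip: power_add)
      then show "c / r ^ n * hermite_C n T *
          (if j \<le> n then of_nat (m choose j) * (-1) ^ j * z ^ (m - j) * (cnj z ^ (n - j) / fact (n - j)) else 0)
          = (if j \<le> n then b j * (hermite_C n T * u ^ (n - j) / fact (n - j)) else 0)"
        by (simp add: b_def u_def power_divide mult_ac)
    qed
    finally show ?thesis .
  qed
  have "(\<lambda>n. if j \<le> n then b j * (hermite_C n T * u ^ (n - j) / fact (n - j)) else 0) sums
          (b j * (exp (2 * T * u - u\<^sup>2) * hermite_C j (T - u)))" for j
    \<comment> \<open>The first \<open>j\<close> terms vanish; the remaining ones are indexed by \<open>k = n - j\<close>.\<close>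
    by (subst sums_zero_iff_shift[of j, symmetric])
       (use sums_mult[OF hermite_C_shifted_generating_function] in auto)
  then have "complex_kernel_term m t z sums
      (\<Sum>j\<le>m. b j * (exp (2 * T * u - u\<^sup>2) * hermite_C j (T - u)))"
    unfolding term_eq[abs_def] by (rule sums_sum)
  also have "(\<Sum>j\<le>m. b j * (exp (2 * T * u - u\<^sup>2) * hermite_C j (T - u))) =
      (\<Sum>j\<le>m. c * exp (2 * T * u - u\<^sup>2) / r ^ m *
          (of_nat (m choose j) * (2 * (z / r)) ^ (m - j) * hermite_C j (u - T)))"
  proof (intro sum.cong refl)
    fix j assume "j \<in> {..m}"
    then have "r ^ m = r ^ j * r ^ (m - j)"
      by (simp flip: power_add)
    moreover have "2 * (z / r) = r * z"
      using r by (simp add: field_simps)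
    then have "(2 * (z / r)) ^ (m - j) = r ^ (m - j) * z ^ (m - j)"
      by (simp only: power_mult_distrib)
    moreover have "hermite_C j (T - u) = (-1) ^ j * hermite_C j (u - T)"
      using hermite_C_minus[of j "u - T"] by simp
    moreover have "(-1::complex) ^ j * (-1) ^ j = 1"
      by (simp flip: power_mult_distrib)
    ultimately show "b j * (exp (2 * T * u - u\<^sup>2) * hermite_C j (T - u)) =
        c * exp (2 * T * u - u\<^sup>2) / r ^ m *
          (of_nat (m choose j) * (2 * (z / r)) ^ (m - j) * hermite_C j (u - T))"
      using r(1) by (simp add: b_def mult_ac)
  qed
  also have "\<dots> = c * exp (2 * T * u - u\<^sup>2) / r ^ m * hermite_C m (u - T + z / r)"
    by (simp only: hermite_C_add sum_distrib_left)
  also have "u - T + z / r = (z + cnj z) / of_real (sqrt 2) - of_real t"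
    by (simp add: u_def T_def r_def add_divide_distrib)
  also have "c * exp (2 * T * u - u\<^sup>2) / r ^ m =
      exp (- of_real (t\<^sup>2) / 2 - (cnj z)\<^sup>2 / 2 + of_real (sqrt 2) * cnj z * of_real t)
        / of_real (pi powr (3 / 4) * sqrt 2 ^ m * sqrt (fact m))"
  proof -
    have linear: "2 * T * u = r * cnj z * T"
      using r by (simp add: u_def field_simps)
    have quadratic: "u\<^sup>2 = (cnj z)\<^sup>2 / 2"
      using r by (simp add: u_def power_divide)
    have "- of_real (t\<^sup>2) / 2 - (cnj z)\<^sup>2 / 2 + r * cnj z * T =
        of_real (- t\<^sup>2 / 2) + (2 * T * u - u\<^sup>2)"
      unfolding linear quadratic by simp
    then have "exp (- of_real (t\<^sup>2) / 2 - (cnj z)\<^sup>2 / 2 + r * cnj z * T) =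
        of_real (exp (- t\<^sup>2 / 2)) * exp (2 * T * u - u\<^sup>2)"
      by (simp only: exp_add exp_of_real)
    then show ?thesis
      by (simp add: c_def r_def T_def)
  qed
  finally show ?thesis .
qed

section \<open>Complex slices of the quaternions\<close>

text \<open>For a quaternion \<open>I\<close> with \<open>I\<^sup>2 = -1\<close> this is the embedding of the complex numbers that sends
  the imaginary unit to \<open>I\<close>.\<close>

definition slice :: "quat \<Rightarrow> complex \<Rightarrow> quat" where
  "slice I z = of_real (Re z) + Im z *\<^sub>R I"

lemma bounded_linear_slice: "bounded_linear (slice I)"
  unfolding slice_def
  by (intro bounded_linear_add bounded_linear_scaleR_const bounded_linear_Re bounded_linear_Im
        bounded_linear_compose[OF bounded_linear_of_real])

lemma slice_of_real [simp]: "slice I (of_real x) = of_real x"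
  by (simp add: slice_def)

lemma slice_linear [simp]:
  "slice I (z + w) = slice I z + slice I w" "slice I (z - w) = slice I z - slice I w"
  "slice I (- z) = - slice I z" "slice I (x *\<^sub>R z) = x *\<^sub>R slice I z"
  "slice I (sum f A) = (\<Sum>a\<in>A. slice I (f a))"
  using bounded_linear.linear[OF bounded_linear_slice, of I]
  by (simp_all add: linear_add linear_diff linear_neg linear_cmul linear_sum)

lemma slice_mult:
  assumes "I * I = -1"
  shows "slice I (z * w) = slice I z * slice I w"
proof -
  have "slice I z * slice I w =
      of_real (Re z * Re w) + (Re z * Im w + Im z * Re w) *\<^sub>R I + (Im z * Im w) *\<^sub>R (I * I)"
    by (simp add: slice_def of_real_def algebra_simps)
  then show ?thesis
    by (simp add: assms slice_def of_real_def algebra_simps)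
qed

lemma slice_power:
  assumes "I * I = -1"
  shows "slice I (z ^ n) = slice I z ^ n"
  using slice_of_real[of I 1] by (induction n) (simp_all add: slice_mult assms)

lemma slice_exp:
  assumes "I * I = -1"
  shows "slice I (exp z) = exp (slice I z)"
proof -
  have "(\<lambda>n. slice I (z ^ n /\<^sub>R fact n)) sums slice I (exp z)"
    by (rule bounded_linear.sums[OF bounded_linear_slice exp_converges])
  then have "(\<lambda>n. slice I z ^ n /\<^sub>R fact n) sums slice I (exp z)"
    by (simp add: slice_power assms)
  then show ?thesis
    using exp_converges sums_unique2 by blast
qed

lemma slice_divide_of_real: "slice I (z / of_real x) = slice I z / of_real x"
proof -
  have "z / of_real x = inverse x *\<^sub>R z" "slice I z / of_real x = inverse x *\<^sub>R slice I z"
    by (simp_all add: scaleR_conv_of_real divide_inverse mult.commute flip: of_real_inverse)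
       (simp add: of_real_def)
  then show ?thesis
    by simp
qed

lemma qcnj_slice:
  assumes "qRe I = 0"
  shows "qcnj (slice I z) = slice I (cnj z)"
  by (simp add: slice_def quat_eq_iff assms)

text \<open>The unit \<open>I\<close> is the normalised imaginary part of \<open>q\<close>. A real \<open>q\<close> lies in every slice, and the
  first standard unit is chosen.\<close>

lemma quat_in_slice:
  obtains I z where "q = slice I z" "I * I = -1" "qRe I = 0"
proof -
  define s where "s = sqrt ((qIm1 q)\<^sup>2 + (qIm2 q)\<^sup>2 + (qIm3 q)\<^sup>2)"
  show thesis
  proof (cases "s = 0")
    case True
    then have "qIm1 q = 0" "qIm2 q = 0" "qIm3 q = 0"
      by (auto simp: s_def add_nonneg_eq_0_iff)
    then have "q = slice (Quat 0 1 0 0) (of_real (qRe q))"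
      by (simp add: slice_def quat_eq_iff)
    then show thesis
      by (rule that) (simp_all add: quat_eq_iff)
  next
    case False
    define I where "I = Quat 0 (qIm1 q / s) (qIm2 q / s) (qIm3 q / s)"
    have ss: "s * s = qIm1 q * qIm1 q + qIm2 q * qIm2 q + qIm3 q * qIm3 q"
      unfolding s_def by (simp add: power2_eq_square)
    have "q = slice I (Complex (qRe q) s)"
      using False by (simp add: slice_def quat_eq_iff I_def)
    moreover have "qIm1 q * qIm1 q / (s * s) + qIm2 q * qIm2 q / (s * s) + qIm3 q * qIm3 q / (s * s) = 1"
      using False by (simp flip: ss add_divide_distrib)
    then have "I * I = -1"
      by (simp add: I_def quat_eq_iff)
    moreover have "qRe I = 0"
      by (simp add: I_def)
    ultimately show thesis
      by (rule that)
  qed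
qed

lemma kernel_term_slice:
  assumes "I * I = -1" "qRe I = 0"
  shows "kernel_term m t (slice I z) n = slice I (complex_kernel_term m t z n)"
  unfolding kernel_term_def complex_kernel_term_def quat_hermite_def complex_hermite_def
  by (simp add: slice_mult slice_power qcnj_slice assms)

theorem theorem6p1:
  fixes m :: nat and t :: real and q :: quat
  shows "summable (kernel_term m t q) \<and>
    kernel_A m t q =
      exp (- of_real (t\<^sup>2) / 2 - (qcnj q)\<^sup>2 / 2 + of_real (sqrt 2) * qcnj q * of_real t)
        / of_real (pi powr (3 / 4) * sqrt 2 ^ m * sqrt (fact m))
        * of_real (hermite_H m (qRe ((q + qcnj q) / of_real (sqrt 2) - of_real t)))"
    (is "_ \<and> _ = ?R")
proof -
  obtain I z where q: "q = slice I z" and I: "I * I = -1" "qRe I = 0"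
    by (rule quat_in_slice)
  define x where "x = qRe ((q + qcnj q) / of_real (sqrt 2) - of_real t)"
  have half: "slice I (w / 2) = slice I w / 2" for w
    using slice_divide_of_real[of I w 2] by simp
  have x: "(z + cnj z) / of_real (sqrt 2) - of_real t = of_real x"
    by (simp add: x_def q qcnj_slice[OF I(2)] slice_divide_of_real flip: slice_linear)
       (simp add: complex_eq_iff slice_def I divide_inverse flip: of_real_inverse)
  have "(\<lambda>n. slice I (complex_kernel_term m t z n)) sums
      slice I (exp (- of_real (t\<^sup>2) / 2 - (cnj z)\<^sup>2 / 2 + of_real (sqrt 2) * cnj z * of_real t)
        / of_real (pi powr (3 / 4) * sqrt 2 ^ m * sqrt (fact m)) * hermite_C m (of_real x))"
    using complex_kernel_sums[of m t z] unfolding x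
    by (rule bounded_linear.sums[OF bounded_linear_slice])
  moreover have "kernel_term m t q = (\<lambda>n. slice I (complex_kernel_term m t z n))"
    by (simp add: q kernel_term_slice[OF I] fun_eq_iff)
  ultimately have "kernel_term m t q sums ?R"
    unfolding x_def[symmetric] hermite_C_of_real
    by (simp only: q kernel_term_slice[OF I] slice_mult[OF I(1)] slice_divide_of_real slice_exp[OF I(1)]
          slice_linear half slice_power[OF I(1)] slice_of_real qcnj_slice[OF I(2)])
  then show ?thesis
    unfolding kernel_A_def by (simp add: sums_iff)
qed

end
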